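(* Let $q$ be a prime power and let $n,m,k$ be positive integers with $k\le n\le km$. Then $$ L_{\mathrm{rk}}(n,m,k,q)= \begin{cases} n-\max\left\{\left\lfloor \dfrac{n}{2^{k-1}}\right\rfloor,1\right\}+1 & \text{if } n\le m,\\[1em] m-\max\left\{\left\lfloor \dfrac{n-(k-t-2)m}{2^{t+1}}\right\rfloor,1\right\}+1 & \text{if } n>m, \end{cases} $$ where $t=\left\lfloor k-\dfrac{n}{m}\right\rfloor$.
   Context: $\mathbb{F}_{q^m}$ denotes the degree-$m$ extension of the finite field $\mathbb{F}_q$. For $\mathbf v=(v_1,\dots,v_n)\in\mathbb{F}_{q^m}^n$, its rank weight is $\mathrm{w}(\mathbf v)=\dim_{\mathbb{F}_q}\langle v_1,\dots,v_n\rangle_{\mathbb{F}_q}$. An $[n,k]_{q^m/q}$ code is a $k$-dimensional $\mathbb{F}_{q^m}$-linear subspace $\mathcal C$ of $\mathbb{F}_{q^m}^n$ (endowed with the rank distance $d(\mathbf u,\mathbf v)=\mathrm{w}(\mathbf u-\mathbf v)$). A generator matrix of $\mathcal C$ is a matrix $G\in\mathbb{F}_{q^m}^{k\times n}$ whose rows span $\mathcal C$. The code is nondegenerate if the $\mathbb{F}_q$-linear span of the columns of a generator matrix has $\mathbb{F}_q$-dimension $n$. The weight spectrum is $\mathrm{WS}(\mathcal C)=\{\mathrm{w}(\mathbf c):\mathbf c\in\mathcal C,\ \mathbf c\neq \mathbf 0\}$. $L_{\mathrm{rk}}(n,m,k,q)$ denotes the maximum of $|\mathrm{WS}(\mathcal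 C)|$ over all nondegenerate $[n,k]_{q^m/q}$ codes $\mathcal C$. *)

theory Defs
  imports "HOL-Analysis.Analysis" "HOL-Number_Theory.Prime_Powers"
begin

text \<open>
  The extension \<open>F_{q^m} / F_q\<close> is given by a field homomorphism \<open>\<iota> :: 'f \<Rightarrow> 'e\<close> from the type
  \<open>'f\<close> of \<open>F_q\<close> to the type \<open>'e\<close> of \<open>F_{q^m}\<close>. The lengths \<open>n\<close> and dimensions \<open>k\<close> are the cardinalities
  of the index types \<open>'n\<close> and \<open>'k\<close>; a \<open>k \<times> n\<close> matrix over \<open>'e\<close> has type \<open>'e^'n^'k\<close>.
\<close>

definition field_embedding :: "('f::field \<Rightarrow> 'e::field) \<Rightarrow> bool" where
  "field_embedding \<iota> \<longleftrightarrow>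
     \<iota> 1 = 1 \<and> (\<forall>x y. \<iota> (x + y) = \<iota> x + \<iota> y) \<and> (\<forall>x y. \<iota> (x * y) = \<iota> x * \<iota> y)"

definition base_scale :: "('f::field \<Rightarrow> 'e::field) \<Rightarrow> 'f \<Rightarrow> 'e \<Rightarrow> 'e" where
  "base_scale \<iota> a x = \<iota> a * x"

definition base_scale_vec :: "('f::field \<Rightarrow> 'e::field) \<Rightarrow> 'f \<Rightarrow> 'e^'k \<Rightarrow> 'e^'k" where
  "base_scale_vec \<iota> a v = \<iota> a *s v"

definition field_extension_of_degree :: "('f::field \<Rightarrow> 'e::field) \<Rightarrow> nat \<Rightarrow> bool" where
  "field_extension_of_degree \<iota> m \<longleftrightarrow>
     field_embedding \<iota> \<and> vector_space.dim (base_scale \<iota>) (UNIV :: 'e set) = m"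

definition rank_weight :: "('f::field \<Rightarrow> 'e::field) \<Rightarrow> 'e^'n \<Rightarrow> nat" where
  "rank_weight \<iota> v =
     vector_space.dim (base_scale \<iota>) (module.span (base_scale \<iota>) (range (\<lambda>i. v $ i)))"

definition linear_code :: "'k::finite itself \<Rightarrow> ('e::field^'n) set \<Rightarrow> bool" where
  "linear_code TYPE('k) C \<longleftrightarrow> vec.subspace C \<and> vec.dim C = CARD('k)"

definition generator_matrix :: "'e::field^'n^'k \<Rightarrow> ('e^'n) set \<Rightarrow> bool" where
  "generator_matrix G C \<longleftrightarrow> vec.span (rows G) = C"

definition nondegenerate ::
    "('f::field \<Rightarrow> 'e::field) \<Rightarrow> 'k::finite itself \<Rightarrow> ('e^'n) set \<Rightarrow> bool" where
  "nondegenerate \<iota> TYPE('k) C \<longleftrightarrow>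
     (\<exists>G :: 'e^'n^'k. generator_matrix G C \<and>
        vector_space.dim (base_scale_vec \<iota>) (module.span (base_scale_vec \<iota>) (columns G))
          = CARD('n))"

definition weight_spectrum :: "('f::field \<Rightarrow> 'e::field) \<Rightarrow> ('e^'n) set \<Rightarrow> nat set" where
  "weight_spectrum \<iota> C = {rank_weight \<iota> c | c. c \<in> C \<and> c \<noteq> 0}"

definition L_rk ::
    "('f::field \<Rightarrow> 'e::field) \<Rightarrow> 'n::finite itself \<Rightarrow> 'k::finite itself \<Rightarrow> nat" where
  "L_rk \<iota> TYPE('n) TYPE('k) =
     Max {card (weight_spectrum \<iota> C) | C :: ('e^'n) set.
            linear_code TYPE('k) C \<and> nondegenerate \<iota> TYPE('k) C}"

end

theory Submission
  imports Defs "HOL-Algebra.Multiplicative_Group"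
begin

text \<open>
  For a set \<open>D\<close> of codewords, let \<open>n(D)\<close> be \<open>n\<close> minus the dimension of the space of vectors over
  \<open>F_q\<close> orthogonal to \<open>D\<close>. Every word of \<open>D\<close> has weight at most \<open>n(D)\<close>, adjoining a word \<open>c\<close> raises
  \<open>n(D)\<close> by at most \<open>w(c)\<close>, and \<open>n(C) = n\<close> for a nondegenerate code.

  Upper bound: build \<open>C\<close> as a chain of subcodes \<open>D_0 < D_1 < ... < D_k\<close>, adjoining at each step a
  word of least weight \<open>\<lambda>\<close> among those not yet generated. The integers strictly between \<open>n(D_j)\<close> and
  \<open>\<lambda>\<close> are then not weights of \<open>C\<close>, and if there are \<open>d\<close> of them then
  \<open>n(D_{j+1}) + 1 \<le> 2 (n(D_j) + 1) + d\<close>. So \<open>n(D_j) + 1 \<le> 2^(j-1) (g + 1)\<close>, where \<open>g - 1\<close> is the number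
  of missed weights found so far. As weights never exceed \<open>m\<close>, one can also stop at any \<open>j = K\<close> and
  use \<open>n(D_K) \<ge> n - (k - K) m\<close>; the case \<open>n > m\<close> takes \<open>K = t + 2\<close>.

  Lower bound: let \<open>\<alpha>\<close> generate the multiplicative group of \<open>F_{q^m}\<close>, so that
  \<open>1, \<alpha>, ..., \<alpha>^(L-1)\<close> span a space of dimension \<open>min L m\<close>. Take a block diagonal generator matrix
  whose \<open>i\<close>-th row is \<open>1, \<alpha>, ..., \<alpha>^(l_i-1)\<close> on its block. Multiplying rows by powers of \<open>\<alpha>\<close> shifts
  the intervals of exponents, so if \<open>l_0 = g\<close> and \<open>l_{j+1} \<le> l_0 + ... + l_j + 1\<close>, intervals can be
  glued to \<open>{0..<L}\<close> for every \<open>L\<close> between \<open>g\<close> and \<open>n\<close>.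
\<close>

section \<open>Rank and nullity\<close>

text \<open>Extend a basis \<open>B\<close> of the kernel within \<open>S\<close> to a basis
  \<open>A\<close> of \<open>S\<close>: \<open>f\<close> is injective on the span of
  \<open>A - B\<close>, which has the same image as \<open>S\<close>.\<close>

lemma (in finite_dimensional_vector_space_pair_1) rank_nullity_subspace:
  assumes lf: "Vector_Spaces.linear s1 s2 f" and S: "vs1.subspace S"
  shows "vs1.dim {x \<in> S. f x = 0} + vs2.dim (f ` S) = vs1.dim S"
proof -
  interpret lf: Vector_Spaces.linear s1 s2 f by fact
  let ?K = "{x \<in> S. f x = 0}"
  have K: "vs1.subspace ?K"
    using vs1.subspace_inter[OF S lf.subspace_kernel] by (simp add: Collect_conj_eq Int_commute)
  obtain B where B: "B \<subseteq> ?K" "vs1.independent B" "?K \<subseteq> vs1.span B" "card B = vs1.dim ?K"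
    using vs1.basis_exists by blast
  then have "B \<subseteq> S" by auto
  then obtain A where A: "B \<subseteq> A" "A \<subseteq> S" "vs1.independent A" "S \<subseteq> vs1.span A"
    using vs1.maximal_independent_subset_extend[OF _ B(2)] by metis
  have fin: "finite A" using A(3) vs1.finiteI_independent by blast
  have spA: "vs1.span A = S" using A S by (simp add: vs1.span_subspace)
  have spB: "vs1.span B = ?K" using B K by (simp add: vs1.span_subspace)
  let ?T = "vs1.span (A - B)"
  have indT: "vs1.independent (A - B)" using A(3) vs1.independent_mono by blast
  have disj: "vs1.span B \<inter> ?T \<subseteq> {0}"
  proof
    fix x assume "x \<in> vs1.span B \<inter> ?T"
    moreover have "finite B" "finite (A - B)" using fin A(1) by (auto intro: finite_subset)
    ultimately have "x \<in> range (\<lambda>a. \<Sum>v\<in>B. s1 (a v) v)" "x \<in> range (\<lambda>b. \<Sum>v\<in>A - B. s1 (b v) v)"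
      by (simp_all add: vs1.span_finite)
    then obtain a b where a: "x = (\<Sum>v\<in>B. s1 (a v) v)" and b: "x = (\<Sum>v\<in>A - B. s1 (b v) v)"
      by blast
    \<comment> \<open>Subtracting the two expansions of \<open>x\<close> gives one linear relation
      on \<open>A\<close>, so all coefficients vanish.\<close>
    define c where "c v = (if v \<in> B then a v else - b v)" for v
    have "(\<Sum>v\<in>A. s1 (c v) v) = (\<Sum>v\<in>A - B. s1 (c v) v) + (\<Sum>v\<in>B. s1 (c v) v)"
      using A(1) fin by (rule sum.subset_diff)
    also have "\<dots> = 0" using a b by (simp add: c_def sum_negf)
    finally have "c v = 0" if "v \<in> A" for v
      using vs1.independentD[OF A(3) fin subset_refl] that by blast
    then have "a v = 0" if "v \<in> B" for v using that A(1) c_def by (metis subsetD)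
    then show "x \<in> {0}" using a by simp
  qed
  have T_S: "?T \<subseteq> S" using spA vs1.span_mono[of "A - B" A] by auto
  have inj: "inj_on f ?T"
  proof (rule inj_onI)
    fix x y assume xy: "x \<in> ?T" "y \<in> ?T" "f x = f y"
    then have d: "x - y \<in> ?T" by (simp add: vs1.span_diff)
    moreover have "f (x - y) = 0" using xy by (simp add: lf.diff)
    ultimately have "x - y \<in> vs1.span B" using T_S spB by auto
    with d disj show "x = y" by auto
  qed
  have "f ` S = vs2.span (f ` A)" using lf.span_image[of A] spA by simp
  also have "\<dots> = vs2.span (f ` (A - B))"
  proof -
    have "f ` A \<subseteq> insert 0 (f ` (A - B))" using B(1) by auto
    moreover have "f ` (A - B) \<subseteq> f ` A" by auto
    ultimately show ?thesis
      by (metis subset_antisym vs2.span_insert_0 vs2.span_mono)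
  qed
  finally have "vs2.dim (f ` S) = vs2.dim (f ` (A - B))" by simp
  also have "\<dots> = vs1.dim (A - B)" using dim_image_eq[OF lf inj] .
  also have "\<dots> = card (A - B)" using indT vs1.dim_eq_card_independent by blast
  also have "\<dots> = card A - card B" using A(1) fin by (simp add: card_Diff_subset finite_subset)
  finally have "vs2.dim (f ` S) = card A - card B" .
  moreover have "card B \<le> card A" using A(1) fin card_mono by blast
  moreover have "card A = vs1.dim S" using A vs1.basis_card_eq_dim by blast
  ultimately show ?thesis using B(4) by simp
qed

lemma (in vector_space) finite_dimensional_if_finite:
  assumes "finite (UNIV :: 'b set)"
  shows "finite_dimensional_vector_space scale (extend_basis {})"
proof unfold_locales
  show "finite (extend_basis {})" using assms by (rule finite_subset[OF subset_UNIV])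
qed (simp_all add: independent_extend_basis independent_empty)

text \<open>The scaling is a parameter because three are used: F_q on the entries of a word, F_q on
  the columns of a matrix, and F_{q^m} on its rows.\<close>

definition lincomb :: "('f::field \<Rightarrow> 'b \<Rightarrow> 'b::ab_group_add) \<Rightarrow> ('n::finite \<Rightarrow> 'b) \<Rightarrow> 'f^'n \<Rightarrow> 'b"
  where "lincomb s u a = (\<Sum>i\<in>UNIV. s (a $ i) (u i))"

context vector_space
begin

lemma linear_lincomb: "Vector_Spaces.linear vector_scalar_mult scale (lincomb scale u)"
  by (auto simp: Vector_Spaces.linear_iff lincomb_def vector_space_axioms vec.vector_space_axioms
      scale_left_distrib scale_sum_right sum.distrib)

lemma range_lincomb: "range (lincomb scale u) = span (range u)"
proof
  show "range (lincomb scale u) \<subseteq> span (range u)"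
    unfolding lincomb_def by (intro image_subsetI span_sum span_scale span_base rangeI)
  interpret l: Vector_Spaces.linear vector_scalar_mult scale "lincomb scale u" by (rule linear_lincomb)
  have "u i = lincomb scale u (axis i 1)" for i
    by (simp add: lincomb_def axis_def if_distrib[of "\<lambda>x. scale x _"] cong: if_cong)
  then have "range u \<subseteq> range (lincomb scale u)" by auto
  then show "span (range u) \<subseteq> range (lincomb scale u)"
    by (intro span_minimal l.subspace_image vec.subspace_UNIV) 
qed

lemma rank_nullity_lincomb:
  fixes u :: "'n::finite \<Rightarrow> 'b" and S :: "('a^'n) set"
  assumes "vec.subspace S"
  shows "vec.dim {a \<in> S. lincomb scale u a = 0} + dim (lincomb scale u ` S) = vec.dim S"
proof -
  interpret p: finite_dimensional_vector_space_pair_1 vector_scalar_mult "cart_basis :: ('a^'n) set" scale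
    by unfold_locales
  show ?thesis by (rule p.rank_nullity_subspace[OF linear_lincomb assms])
qed

corollary dim_kernel_lincomb:
  fixes u :: "'n::finite \<Rightarrow> 'b"
  shows "vec.dim {a. lincomb scale u a = 0} + dim (span (range u)) = CARD('n)"
  using rank_nullity_lincomb[of UNIV u] by (simp add: range_lincomb card_cart_basis)

end

section \<open>Effective lengths and the upper bound\<close>

text \<open>Here \<open>x\<close> and \<open>y\<close> are the effective lengths before and after
  adjoining a word of weight \<open>l\<close>; \<open>b\<close> weights were missed before and
  \<open>d\<close> are new. For \<open>K = Suc j\<close> the length doubles via
  \<open>l \<le> x + 1 + d\<close>; for smaller \<open>K\<close> it grows by at most
  \<open>m\<close>. The overall factor 2 allows \<open>K = 0\<close>, where
  \<open>2 ^ (K - 1)\<close> would be wrong.\<close>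

lemma gap_bound_step:
  fixes b d x y l m K j :: nat
  assumes "\<forall>K\<le>j. 2 * (x + 1) \<le> 2 ^ K * (b + 2) + 2 * (j - K) * m"
    and "y \<le> x + l" "l \<le> m" "l \<le> x + 1 + d" "K \<le> Suc j"
  shows "2 * (y + 1) \<le> 2 ^ K * (b + d + 2) + 2 * (Suc j - K) * m"
proof (cases "K = Suc j")
  case True
  have "2 * (x + 1) \<le> 2 ^ j * (b + 2)" using assms(1)[rule_format, of j] by simp
  moreover have "d \<le> 2 ^ j * d" by simp
  ultimately have "2 * (x + 1) + d \<le> 2 ^ j * (b + 2) + 2 ^ j * d" by (rule add_mono)
  then show ?thesis using True assms by (simp add: algebra_simps)
next
  case False
  then have K: "K \<le> j" using assms by simp
  have "2 * (y + 1) \<le> 2 * (x + 1) + 2 * m" using assms(2,3) by simp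
  also have "\<dots> \<le> (2 ^ K * (b + 2) + 2 * (j - K) * m) + 2 * m" using assms(1) K by simp
  also have "\<dots> \<le> 2 ^ K * (b + d + 2) + (2 * (j - K) * m + 2 * m)" by simp
  also have "2 * (j - K) * m + 2 * m = 2 * (Suc j - K) * m"
    using K by (auto dest!: le_Suc_ex simp: algebra_simps)
  finally show ?thesis .
qed

locale finite_field_extension =
  fixes \<iota> :: "'f::{field,finite} \<Rightarrow> 'e::{field,finite}"
  assumes embedding: "field_embedding \<iota>"
begin

lemma vector_space_base_scale: "vector_space (base_scale \<iota>)"
  using embedding by unfold_locales (auto simp: field_embedding_def base_scale_def algebra_simps)

lemma vector_space_base_scale_vec:
  "vector_space (base_scale_vec \<iota> :: 'f \<Rightarrow> 'e^'k::finite \<Rightarrow> 'e^'k)"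
  using embedding
  by unfold_locales (auto simp: field_embedding_def base_scale_vec_def vec_eq_iff algebra_simps)

sublocale E: finite_dimensional_vector_space "base_scale \<iota>"
  "vector_space.extend_basis (base_scale \<iota>) {}"
  by (rule vector_space.finite_dimensional_if_finite[OF vector_space_base_scale]) simp

declare E.dim_UNIV [simp del]

text \<open>As an F_q-linear map in its second argument, \<open>comb c\<close> has the span of the
  entries of \<open>c\<close> as its image, so its rank is the weight of \<open>c\<close>.\<close>

definition comb :: "'e^'n::finite \<Rightarrow> 'f^'n \<Rightarrow> 'e" where
  "comb c = lincomb (base_scale \<iota>) (($) c)"

lemma comb_eq_sum: "comb c a = (\<Sum>i\<in>UNIV. \<iota> (a $ i) * c $ i)"
  by (simp add: comb_def lincomb_def base_scale_def)

lemma comb_add: "comb (c + d) a = comb c a + comb d a"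
  and comb_scale: "comb (x *s c) a = x * comb c a"
  and comb_0: "comb 0 a = 0"
  by (simp_all add: comb_eq_sum algebra_simps sum.distrib sum_distrib_left)

definition annih :: "('e^'n::finite) set \<Rightarrow> ('f^'n) set" where
  "annih D = {a. \<forall>c\<in>D. comb c a = 0}"

definition eff_length :: "('e^'n::finite) set \<Rightarrow> nat" where
  "eff_length D = CARD('n) - vec.dim (annih D)"

lemma subspace_annih: "vec.subspace (annih D)"
proof -
  have "vec.subspace {a. comb c a = 0}" for c :: "'e^'n"
  proof -
    interpret l: Vector_Spaces.linear "(*s)" "base_scale \<iota>" "comb c" unfolding comb_def by (rule E.linear_lincomb)
    show ?thesis by (rule l.subspace_kernel)
  qed
  then have "vec.subspace (\<Inter>c\<in>D. {a. comb c a = 0})" by (intro vec.subspace_Int)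
  moreover have "annih D = (\<Inter>c\<in>D. {a. comb c a = 0})" by (auto simp: annih_def)
  ultimately show ?thesis by simp
qed

text \<open>The pairing \<open>comb\<close> is linear over the large field in the word, although the
  vectors paired with it are over F_q.\<close>

lemma annih_span: "annih (vec.span D) = annih D"
proof
  show "annih (vec.span D) \<subseteq> annih D" by (auto simp: annih_def vec.span_base)
  show "annih D \<subseteq> annih (vec.span D)"
  proof
    fix a assume a: "a \<in> annih D"
    have "comb c a = 0" if "c \<in> vec.span D" for c
      using that
      by (induction rule: vec.span_induct_alt)
        (use a in \<open>simp_all add: comb_0 comb_add comb_scale annih_def\<close>)
    then show "a \<in> annih (vec.span D)" by (simp add: annih_def)
  qed
qed

lemma eff_length_span: "eff_length (vec.span D) = eff_length D"
  by (simp add: eff_length_def annih_span)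

lemma eff_length_zero: "eff_length {0 :: 'e^'n::finite} = 0"
  by (simp add: eff_length_def annih_def comb_0 card_cart_basis)

lemma rank_weight_eq: "rank_weight \<iota> c = E.dim (range (($) c))"
  by (simp add: rank_weight_def)

lemma rank_weight_le_degree: "rank_weight \<iota> c \<le> E.dim UNIV"
  unfolding rank_weight_eq by (rule E.dim_subset) simp

lemma rank_weight_pos: "c \<noteq> 0 \<Longrightarrow> 0 < rank_weight \<iota> c"
  using E.dim_eq_0[of "range (($) c)"] by (auto simp: rank_weight_eq vec_eq_iff simp del: E.dim_eq_0)

text \<open>The annihilator of \<open>D\<close> lies in the kernel of \<open>comb c\<close>, whose
  codimension is the weight of \<open>c\<close>.\<close>

lemma rank_weight_le_eff_length:
  fixes c :: "'e^'n::finite"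
  assumes "c \<in> D"
  shows "rank_weight \<iota> c \<le> eff_length D"
proof -
  have "vec.dim (annih D) \<le> vec.dim {a. comb c a = 0}"
    using assms by (intro vec.dim_subset) (auto simp: annih_def)
  then show ?thesis
    using E.dim_kernel_lincomb[of "($) c", folded comb_def] by (simp add: eff_length_def rank_weight_eq)
qed

text \<open>Rank-nullity for \<open>comb c\<close> restricted to \<open>annih D\<close>: the image
  lies in the span of the entries of \<open>c\<close>.\<close>

lemma eff_length_insert:
  fixes c :: "'e^'n::finite"
  shows "eff_length (insert c D) \<le> eff_length D + rank_weight \<iota> c"
proof -
  have "E.dim (comb c ` annih D) \<le> rank_weight \<iota> c"
    unfolding rank_weight_def E.range_lincomb[symmetric] comb_def by (rule E.dim_subset) auto
  moreover have "annih (insert c D) = {a \<in> annih D. comb c a = 0}" by (auto simp: annih_def)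
  ultimately show ?thesis
    using E.rank_nullity_lincomb[OF subspace_annih, of D "($) c", folded comb_def]
    by (simp add: eff_length_def)
qed

text \<open>A vector over F_q is orthogonal to all rows exactly when it is a linear relation among
  the columns.\<close>

lemma dim_annih_rows:
  fixes G :: "'e^'n::finite^'k::finite"
  shows "vec.dim (annih (rows G)) +
    vector_space.dim (base_scale_vec \<iota>) (module.span (base_scale_vec \<iota>) (columns G)) = CARD('n)"
proof -
  interpret V: vector_space "base_scale_vec \<iota> :: 'f \<Rightarrow> 'e^'k \<Rightarrow> 'e^'k"
    by (rule vector_space_base_scale_vec)
  have "lincomb (base_scale_vec \<iota>) (\<lambda>j. column j G) a $ i = comb (row i G) a" for a i
    by (simp add: comb_eq_sum lincomb_def base_scale_vec_def column_def row_def)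
  then have "annih (rows G) = {a. lincomb (base_scale_vec \<iota>) (\<lambda>j. column j G) a = 0}"
    by (subst vec_eq_iff) (auto simp: annih_def rows_def)
  moreover have "columns G = range (\<lambda>j. column j G)" by (auto simp: columns_def)
  ultimately show ?thesis using V.dim_kernel_lincomb[of "\<lambda>j. column j G"] by simp
qed

lemma nondegenerate_eff_length:
  fixes C :: "('e^'n::finite) set"
  assumes "nondegenerate \<iota> TYPE('k::finite) C"
  shows "eff_length C = CARD('n)"
proof -
  obtain G :: "'e^'n^'k" where G: "vec.span (rows G) = C"
    "vector_space.dim (base_scale_vec \<iota>) (module.span (base_scale_vec \<iota>) (columns G)) = CARD('n)"
    using assms by (auto simp: nondegenerate_def generator_matrix_def)
  have "vec.dim (annih C) = 0" using dim_annih_rows[of G] G by (simp flip: G(1) add: annih_span)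
  then show ?thesis by (simp add: eff_length_def del: vec.dim_eq_0)
qed

text \<open>
  \<open>B\<close> collects the missed weights. Keeping the bound for all \<open>K \<le> j\<close> at once amounts to stopping the
  doubling estimate after \<open>K\<close> steps and bounding weights by the degree from then on.
\<close>

lemma gap_chain:
  fixes C :: "('e^'n::finite) set"
  assumes C: "vec.subspace C" and "j \<le> vec.dim C"
  shows "\<exists>D B. vec.subspace D \<and> D \<subseteq> C \<and> vec.dim D = j \<and>
    B \<subseteq> {1..min (eff_length D) (E.dim UNIV)} \<and> B \<inter> weight_spectrum \<iota> C = {} \<and>
    (\<forall>c\<in>C - D. \<forall>b\<in>B. b < rank_weight \<iota> c) \<and>
    (\<forall>K\<le>j. 2 * (eff_length D + 1) \<le> 2 ^ K * (card B + 2) + 2 * (j - K) * E.dim UNIV)"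
  using assms(2)
proof (induction j)
  case 0
  then show ?case
    using vec.subspace_0[OF C] by (intro exI[of _ "{0}"] exI[of _ "{}"]) (auto simp: eff_length_zero)
next
  case (Suc j)
  then obtain D B where D: "vec.subspace D" "D \<subseteq> C" "vec.dim D = j"
    and B: "B \<subseteq> {1..min (eff_length D) (E.dim UNIV)}" "B \<inter> weight_spectrum \<iota> C = {}"
      "\<forall>c\<in>C - D. \<forall>b\<in>B. b < rank_weight \<iota> c"
    and bound: "\<forall>K\<le>j. 2 * (eff_length D + 1) \<le> 2 ^ K * (card B + 2) + 2 * (j - K) * E.dim UNIV"
    by auto
  have "C - D \<noteq> {}" using D Suc.prems by auto
  then obtain c where c: "c \<in> C" "c \<notin> D"
    and cmin: "\<And>d. d \<in> C - D \<Longrightarrow> rank_weight \<iota> c \<le> rank_weight \<iota> d"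
    using ex_has_least_nat[of "\<lambda>c. c \<in> C - D" _ "rank_weight \<iota>"] by auto
  define l where "l = rank_weight \<iota> c"
  define D' where "D' = vec.span (insert c D)"
  define B' where "B' = B \<union> {eff_length D + 1..<l}"
  have D'C: "D' \<subseteq> C" unfolding D'_def using C D(2) c by (intro vec.span_minimal) auto
  have dim: "vec.dim D' = Suc j"
    using D c by (simp add: D'_def vec.dim_insert vec.span_eq_iff[THEN iffD2])
  have len: "eff_length D' \<le> eff_length D + l"
    unfolding D'_def eff_length_span l_def by (rule eff_length_insert)
  have l_le: "l \<le> E.dim UNIV" "l \<le> eff_length D'"
    unfolding l_def D'_def
    by (auto intro: rank_weight_le_degree rank_weight_le_eff_length vec.span_base)
  have B'l: "b < l" if "b \<in> B'" for b using that B(3) c by (auto simp: B'_def l_def)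
  have "B' \<subseteq> {1..min (eff_length D') (E.dim UNIV)}"
  proof
    fix b assume b: "b \<in> B'"
    have "1 \<le> b" using b B(1) by (auto simp: B'_def)
    with B'l[OF b] l_le show "b \<in> {1..min (eff_length D') (E.dim UNIV)}" by simp
  qed
  \<comment> \<open>Words in \<open>D\<close> have weight at most \<open>eff_length D\<close>, words
    outside have weight at least \<open>l\<close>; nothing falls strictly between.\<close>
  moreover have "B' \<inter> weight_spectrum \<iota> C = {}"
  proof -
    have "rank_weight \<iota> d \<notin> B'" if d: "d \<in> C" "d \<noteq> 0" for d
    proof (cases "d \<in> D")
      case True
      then have "rank_weight \<iota> d \<le> eff_length D" by (rule rank_weight_le_eff_length)
      moreover have "rank_weight \<iota> d \<notin> B" using B(2) d by (auto simp: weight_spectrum_def)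
      ultimately show ?thesis by (simp add: B'_def)
    next
      case False
      then show ?thesis using cmin[of d] d B'l by (force simp: l_def)
    qed
    then show ?thesis by (auto simp: weight_spectrum_def)
  qed
  moreover have "\<forall>d\<in>C - D'. \<forall>b\<in>B'. b < rank_weight \<iota> d"
  proof (intro ballI)
    fix d b assume d: "d \<in> C - D'" and b: "b \<in> B'"
    have "D \<subseteq> D'" by (auto simp: D'_def vec.span_base)
    then have "l \<le> rank_weight \<iota> d" using d cmin[of d] by (auto simp: l_def)
    with B'l[OF b] show "b < rank_weight \<iota> d" by simp
  qed
  moreover have "\<forall>K\<le>Suc j. 2 * (eff_length D' + 1)
      \<le> 2 ^ K * (card B' + 2) + 2 * (Suc j - K) * E.dim UNIV"
  proof (intro allI impI)
    fix K assume "K \<le> Suc j"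
    \<comment> \<open>Old gaps lie at or below \<open>eff_length D\<close>, so the union is
      disjoint. If \<open>l\<close> is at most \<open>eff_length D + 1\<close>, the truncated
      difference is 0 and no gap is added.\<close>
    have "card B' = card B + (l - (eff_length D + 1))"
      unfolding B'_def using B(1) by (subst card_Un_disjoint) (auto intro: finite_subset)
    then show "2 * (eff_length D' + 1) \<le> 2 ^ K * (card B' + 2) + 2 * (Suc j - K) * E.dim UNIV"
      using gap_bound_step[OF bound len l_le(1) _ \<open>K \<le> Suc j\<close>] by simp
  qed
  ultimately show ?case using D'C dim by (intro exI[of _ D'] exI[of _ B']) (auto simp: D'_def)
qed

text \<open>At \<open>j = CARD('k)\<close> the chain has reached \<open>C\<close> itself;
  \<open>g\<close> is one more than the number of missed weights. \<open>K\<close> stays free, to be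
  chosen according to \<open>n\<close> and \<open>m\<close>.\<close>

theorem card_weight_spectrum_le:
  fixes C :: "('e^'n::finite) set"
  assumes lin: "linear_code TYPE('k::finite) C" and nondeg: "nondegenerate \<iota> TYPE('k) C"
    and K: "K \<le> CARD('k)"
  shows "\<exists>g\<ge>1. card (weight_spectrum \<iota> C) + g \<le> min CARD('n) (E.dim UNIV) + 1 \<and>
    2 * (CARD('n) + 1) \<le> 2 ^ K * (g + 1) + 2 * (CARD('k) - K) * E.dim UNIV"
proof -
  let ?M = "min CARD('n) (E.dim UNIV)"
  have C: "vec.subspace C" "vec.dim C = CARD('k)" using lin by (auto simp: linear_code_def)
  note n = nondegenerate_eff_length[OF nondeg]
  obtain D B where D: "vec.subspace D" "D \<subseteq> C" "vec.dim D = CARD('k)"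
    and B: "B \<subseteq> {1..min (eff_length D) (E.dim UNIV)}" "B \<inter> weight_spectrum \<iota> C = {}"
    and bound: "\<forall>K\<le>CARD('k). 2 * (eff_length D + 1)
      \<le> 2 ^ K * (card B + 2) + 2 * (CARD('k) - K) * E.dim UNIV"
    using gap_chain[OF C(1), of "CARD('k)"] C(2) by auto
  have DC: "D = C" using vec.subspace_dim_equal[OF D(1) C(1) D(2)] D(3) C(2) by simp
  have fin: "finite B" using B(1) finite_subset by blast
  have "weight_spectrum \<iota> C \<subseteq> {1..?M} - B"
    using B(2) rank_weight_pos rank_weight_le_degree rank_weight_le_eff_length[of _ C] n
    by (fastforce simp: weight_spectrum_def Suc_le_eq)
  then have "card (weight_spectrum \<iota> C) \<le> card ({1..?M} - B)" by (intro card_mono) auto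
  moreover have "B \<subseteq> {1..?M}" using B(1) DC n by simp
  then have "card ({1..?M} - B) = ?M - card B" "card B \<le> ?M"
    using fin card_mono[of "{1..?M}" B] by (auto simp: card_Diff_subset)
  ultimately have "card (weight_spectrum \<iota> C) + (card B + 1) \<le> ?M + 1" by linarith
  moreover have "2 * (CARD('n) + 1) \<le> 2 ^ K * ((card B + 1) + 1) + 2 * (CARD('k) - K) * E.dim UNIV"
    using bound K DC n by auto
  ultimately show ?thesis by (intro exI[of _ "card B + 1"]) auto
qed

end

section \<open>Interval coverings\<close>

text \<open>Induction on \<open>J\<close>: if \<open>L\<close> exceeds the total of the earlier
  lengths, cover that total and place the last interval so that it ends at \<open>L\<close>.\<close>

lemma intervals_cover:
  fixes l :: "nat \<Rightarrow> nat"
  assumes step: "\<And>j. j < J \<Longrightarrow> l (Suc j) \<le> (\<Sum>i\<le>j. l i) + 1"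
    and "l 0 \<le> L" "L \<le> (\<Sum>i\<le>J. l i)"
  shows "\<exists>S e. S \<subseteq> {..J} \<and> (\<Union>j\<in>S. {e j..<e j + l j}) = {..<L}"
  using assms
proof (induction J arbitrary: L)
  case 0
  then have "L = l 0" by simp
  then show ?case by (intro exI[of _ "{0}"] exI[of _ "\<lambda>_. 0"]) auto
next
  case (Suc J)
  let ?N = "\<Sum>i\<le>J. l i"
  show ?case
  proof (cases "L \<le> ?N")
    case True
    with Suc obtain S e where "S \<subseteq> {..J}" "(\<Union>j\<in>S. {e j..<e j + l j}) = {..<L}"
      by (metis less_SucI)
    then show ?thesis by (intro exI[of _ S] exI[of _ e]) auto
  next
    case False
    have "l 0 \<le> ?N" by (rule member_le_sum) auto
    with Suc obtain S e where S: "S \<subseteq> {..J}" and e: "(\<Union>j\<in>S. {e j..<e j + l j}) = {..<?N}"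
      by (metis less_SucI order_refl)
    \<comment> \<open>From \<open>l (Suc J) \<le> ?N + 1 \<le> L\<close> the subtraction does not
      truncate, and \<open>L \<le> ?N + l (Suc J)\<close> leaves no hole.\<close>
    let ?e = "e(Suc J := L - l (Suc J))"
    have "(\<Union>j\<in>insert (Suc J) S. {?e j..<?e j + l j})
        = {L - l (Suc J)..<L - l (Suc J) + l (Suc J)} \<union> (\<Union>j\<in>S. {?e j..<?e j + l j})" by simp
    also have "(\<Union>j\<in>S. {?e j..<?e j + l j}) = (\<Union>j\<in>S. {e j..<e j + l j})"
      using S by (intro SUP_cong) auto
    also have "{L - l (Suc J)..<L - l (Suc J) + l (Suc J)} \<union> \<dots> = {..<L}"
      using e False Suc.prems(1)[of J] Suc.prems(3) by auto
    finally show ?thesis using S by (intro exI[of _ "insert (Suc J) S"] exI[of _ ?e]) auto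
  qed
qed

text \<open>
  \<open>reach m g j\<close> is the largest total of admissible lengths \<open>l_0, ..., l_j\<close> bounded by \<open>m\<close> with
  \<open>l_0 = g\<close>.
\<close>

fun reach :: "nat \<Rightarrow> nat \<Rightarrow> nat \<Rightarrow> nat" where
  "reach m g 0 = g"
| "reach m g (Suc j) = reach m g j + min (reach m g j + 1) m"

lemma reach_ge_add: "0 < m \<Longrightarrow> g + j \<le> reach m g j"
  by (induction j) (auto simp: min_def)

text \<open>Below the cap, \<open>reach + 1\<close> doubles. Where the cap \<open>m\<close> is
  strictly smaller than \<open>reach + 1\<close>, the total is already at least \<open>m\<close> and
  rises to at least \<open>2 * m\<close>.\<close>

lemma reach_ge_double: "2 * m \<le> reach m g j \<or> 2 ^ j * (g + 1) \<le> reach m g j + 1"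
  by (induction j) (auto simp: min_def)

lemma reach_ge_linear:
  assumes "s \<le> reach m g j" "m \<le> s"
  shows "s + i * m \<le> reach m g (j + i)"
  using assms by (induction i) (auto simp: min_def)

lemma lengths_exist:
  assumes "0 < g" "g \<le> m" "g + j \<le> n" "n \<le> reach m g j"
  shows "\<exists>l. l 0 = g \<and> (\<forall>i\<le>j. 0 < l i \<and> l i \<le> m) \<and>
    (\<forall>i<j. l (Suc i) \<le> (\<Sum>p\<le>i. l p) + 1) \<and> (\<Sum>i\<le>j. l i) = n"
  using assms(3,4)
proof (induction j arbitrary: n)
  case 0
  then show ?case using assms(1,2) by (intro exI[of _ "\<lambda>_. g"]) auto
next
  case (Suc j)
  \<comment> \<open>The earlier lengths take as much as they can while leaving at least 1 for the
    last one.\<close>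
  define n' where "n' = min (n - 1) (reach m g j)"
  have m: "0 < m" using assms by simp
  have "g + j \<le> n'" using Suc.prems reach_ge_add[OF m, of g j] by (simp add: n'_def)
  moreover have "n' \<le> reach m g j" by (simp add: n'_def)
  ultimately obtain l where l: "l 0 = g" "\<forall>i\<le>j. 0 < l i \<and> l i \<le> m"
    "\<forall>i<j. l (Suc i) \<le> (\<Sum>p\<le>i. l p) + 1" "(\<Sum>i\<le>j. l i) = n'"
    using Suc.IH by blast
  have new: "0 < n - n'" "n - n' \<le> m" "n - n' \<le> n' + 1" "n' + (n - n') = n"
    using Suc.prems m by (auto simp: n'_def min_def split: if_splits)
  let ?l = "l(Suc j := n - n')"
  have s: "(\<Sum>p\<le>i. ?l p) = (\<Sum>p\<le>i. l p)" if "i \<le> j" for i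
    using that by (intro sum.cong) auto
  show ?case
  proof (intro exI[of _ ?l] conjI allI impI)
    fix i
    show "?l (Suc i) \<le> (\<Sum>p\<le>i. ?l p) + 1" if "i < Suc j"
      using that s[of i] l(3,4) new by (cases "i = j") auto
  qed (use l new s[of j] in \<open>auto simp: le_Suc_eq\<close>)
qed

section \<open>Block codes and the lower bound\<close>

text \<open>The multiplicative group of a finite field is cyclic; \<open>R\<close> presents the type
  as a field with a carrier so that this theorem applies.\<close>

lemma finite_field_generator:
  "\<exists>g :: 'e::{field,finite}. \<forall>x. x \<noteq> 0 \<longrightarrow> (\<exists>p. x = g ^ p)"
proof -
  define R :: "'e ring" where "R = \<lparr>carrier = UNIV, monoid.mult = (*), one = 1, zero = 0, add = (+)\<rparr>"
  have "\<exists>y. y + x = 0" for x :: 'e by (metis add.left_inverse)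
  then have "cring R"
    by (intro cringI abelian_groupI comm_monoidI) (auto simp: R_def algebra_simps)
  moreover have "\<exists>y. y * x = 1 \<and> x * y = 1" if "x \<noteq> 0" for x :: 'e
    using that by (metis left_inverse right_inverse)
  then have "Units R = carrier R - {\<zero>\<^bsub>R\<^esub>}" by (auto simp: R_def Units_def)
  ultimately have "field R" by (rule cring.cring_fieldI)
  then interpret R: field R .
  obtain g where g: "carrier (mult_of R) = {g [^]\<^bsub>R\<^esub> i | i::nat. i \<in> UNIV}"
    using R.finite_field_mult_group_has_gen by (auto simp: R_def)
  have pow: "x [^]\<^bsub>R\<^esub> p = x ^ p" for x and p :: nat
    by (induction p) (simp_all add: R_def nat_pow_def)
  show ?thesis
  proof (intro exI[of _ g] allI impI)
    fix x :: 'e assume "x \<noteq> 0"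
    then have "x \<in> carrier (mult_of R)" by (simp add: R_def)
    then show "\<exists>p. x = g ^ p" using g pow by auto
  qed
qed

context finite_field_extension
begin

text \<open>Each new power raises the dimension until some \<open>\<alpha> ^ L\<close> depends on
  lower ones. Their span is then closed under multiplication by \<alpha> and contains 1, hence every
  power and so the whole field.\<close>

lemma dim_powers:
  assumes gen: "\<And>x. x \<noteq> 0 \<Longrightarrow> \<exists>p. x = \<alpha> ^ p"
  shows "E.dim ((^) \<alpha> ` {..<L}) = min L (E.dim UNIV)"
proof (induction L)
  case 0
  then show ?case by simp
next
  case (Suc L)
  let ?P = "(^) \<alpha> ` {..<L}"
  have ins: "(^) \<alpha> ` {..<Suc L} = insert (\<alpha> ^ L) ?P" by (simp add: lessThan_Suc)
  show ?case
  proof (cases "\<alpha> ^ L \<in> E.span ?P")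
    case True
    have mult: "\<alpha> * x \<in> E.span ?P" if "x \<in> E.span ?P" for x
      using that
    proof (induction rule: E.span_induct_alt)
      case base
      then show ?case by (simp add: E.span_zero)
    next
      case (step c x y)
      then obtain p where p: "p < L" "x = \<alpha> ^ p" by auto
      have "\<alpha> * x \<in> E.span ?P"
      proof (cases "Suc p = L")
        case True
        then show ?thesis using p \<open>\<alpha> ^ L \<in> E.span ?P\<close> by auto
      next
        case False
        then have "\<alpha> ^ Suc p \<in> ?P" using p by (intro imageI) auto
        then show ?thesis using p by (simp add: E.span_base)
      qed
      then have "base_scale \<iota> c (\<alpha> * x) + \<alpha> * y \<in> E.span ?P"
        using step by (intro E.span_add E.span_scale) auto
      moreover have "base_scale \<iota> c (\<alpha> * x) + \<alpha> * y = \<alpha> * (base_scale \<iota> c x + y)"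
        by (simp add: base_scale_def algebra_simps)
      ultimately show ?case by simp
    qed
    have "L \<noteq> 0" using True by (intro notI) simp
    then have "1 \<in> ?P" by (force simp: image_iff intro!: bexI[of _ 0])
    then have "\<alpha> ^ p \<in> E.span ?P" for p
      by (induction p) (auto simp: E.span_base mult)
    then have "x \<in> E.span ?P" for x
      using gen[of x] by (cases "x = 0") (auto simp: E.span_zero)
    then have "E.dim ?P = E.dim UNIV" by (metis E.dim_span UNIV_eq_I)
    then show ?thesis unfolding ins E.dim_insert using True Suc by simp
  next
    case False
    have "E.dim ((^) \<alpha> ` {..<Suc L}) \<le> E.dim UNIV" by (rule E.dim_subset) simp
    moreover have "E.dim ((^) \<alpha> ` {..<Suc L}) = E.dim ?P + 1"
      unfolding ins E.dim_insert using False by simp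
    ultimately show ?thesis using Suc by (auto simp: min_def split: if_splits)
  qed
qed

lemma powers_independent:
  assumes gen: "\<And>x. x \<noteq> 0 \<Longrightarrow> \<exists>p. x = \<alpha> ^ p"
    and L: "L \<le> E.dim UNIV" and sum0: "(\<Sum>p<L. \<iota> (a p) * \<alpha> ^ p) = 0" and p: "p < L"
  shows "a p = 0"
proof -
  let ?P = "(^) \<alpha> ` {..<L}"
  have dim: "E.dim ?P = L" using dim_powers[OF gen, of L] L by (simp add: min_def)
  have "E.dim ?P \<le> card ?P" by (rule E.dim_le_card) (auto intro: E.span_base)
  moreover have "card ?P \<le> L" using card_image_le[of "{..<L}" "(^) \<alpha>"] by simp
  ultimately have card: "card ?P = L" using dim by simp
  then have inj: "inj_on ((^) \<alpha>) {..<L}" by (intro eq_card_imp_inj_on) auto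
  have ind: "E.independent ?P"
    by (rule E.card_le_dim_spanning[of ?P ?P]) (use dim card in \<open>auto intro: E.span_base\<close>)
  let ?u = "\<lambda>v. a (the_inv_into {..<L} ((^) \<alpha>) v)"
  have "(\<Sum>v\<in>?P. base_scale \<iota> (?u v) v) = (\<Sum>p<L. \<iota> (a p) * \<alpha> ^ p)"
    by (simp add: sum.reindex[OF inj] the_inv_into_f_f[OF inj] base_scale_def)
  then have "?u (\<alpha> ^ p) = 0"
    using sum0 p by (intro E.independentD[OF ind _ subset_refl]) auto
  then show ?thesis using p by (simp add: the_inv_into_f_f[OF inj])
qed

text \<open>The rows are independent because no block is empty; the code is nondegenerate because at
  most m consecutive powers of \<alpha> are independent over F_q.\<close>

lemma block_code_exists:
  fixes l :: "'k::finite \<Rightarrow> nat"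
  assumes gen: "\<And>x. x \<noteq> 0 \<Longrightarrow> \<exists>p. x = \<alpha> ^ p"
    and l: "\<And>i. 0 < l i" "\<And>i. l i \<le> E.dim UNIV" "(\<Sum>i\<in>UNIV. l i) = CARD('n::finite)"
  shows "\<exists>C :: ('e^'n) set. linear_code TYPE('k) C \<and> nondegenerate \<iota> TYPE('k) C \<and>
    (\<forall>x :: 'k \<Rightarrow> 'e. \<exists>c\<in>C. range (($) c) = {x i * \<alpha> ^ p | i p. p < l i})"
proof -
  let ?S = "SIGMA i:(UNIV :: 'k set). {..<l i}"
  have "card ?S = CARD('n)" using l(3) by simp
  \<comment> \<open>\<open>\<phi>\<close> labels each column by its block and the exponent of
    \<alpha> in it.\<close>
  then obtain \<phi> :: "'n \<Rightarrow> 'k \<times> nat" where \<phi>: "bij_betw \<phi> UNIV ?S"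
    using finite_same_card_bij[of "UNIV :: 'n set" ?S] by auto
  define \<psi> where "\<psi> = inv_into UNIV \<phi>"
  have \<psi>\<phi>: "\<psi> (\<phi> v) = v" for v using \<phi> by (simp add: \<psi>_def bij_betw_def)
  have \<phi>\<psi>: "\<phi> (\<psi> (i, p)) = (i, p)" if "p < l i" for i p
    unfolding \<psi>_def using that \<phi> by (intro f_inv_into_f) (auto simp: bij_betw_def)
  have snd_less: "snd (\<phi> v) < l (fst (\<phi> v))" for v
    using bij_betwE[OF \<phi>] by (metis SigmaD2 UNIV_I lessThan_iff prod.collapse)
  define G :: "'e^'n^'k" where "G = (\<chi> i v. if fst (\<phi> v) = i then \<alpha> ^ snd (\<phi> v) else 0)"
  define C where "C = vec.span (rows G)"
  have rows: "rows G = range (\<lambda>i. row i G)" by (auto simp: rows_def)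
  have entry: "lincomb (*s) (\<lambda>i. row i G) a $ v = a $ fst (\<phi> v) * \<alpha> ^ snd (\<phi> v)" for a v
    by (simp add: lincomb_def row_def G_def if_distrib[of "(*) _"] cong: if_cong)
  have "a = 0" if "lincomb (*s) (\<lambda>i. row i G) a = 0" for a
  proof (subst vec_eq_iff, rule allI)
    fix i
    \<comment> \<open>The first column of block \<open>i\<close> has the entry
      \<open>\<alpha> ^ 0 = 1\<close>, so it reads off the coefficient \<open>a $ i\<close>.\<close>
    show "a $ i = 0 $ i" using entry[of a "\<psi> (i, 0)"] that \<phi>\<psi>[OF l(1)[of i]] by simp
  qed
  then have "{a. lincomb (*s) (\<lambda>i. row i G) a = 0} \<subseteq> {0}" by auto
  then have "vec.dim {a. lincomb (*s) (\<lambda>i. row i G) a = 0} = 0" by (simp only: vec.dim_eq_0)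
  then have "linear_code TYPE('k) C"
    using vec.dim_kernel_lincomb[of "\<lambda>i. row i G"]
    by (simp add: linear_code_def C_def rows del: vec.dim_eq_0)
  moreover have "nondegenerate \<iota> TYPE('k) C"
  proof -
    have "a $ v = 0" if a: "a \<in> annih (rows G)" for a v
    proof -
      define i where "i = fst (\<phi> v)"
      have "0 = comb (row i G) a" using a by (auto simp: annih_def rows)
      also have "\<dots> = (\<Sum>v\<in>UNIV. if fst (\<phi> v) = i then \<iota> (a $ v) * \<alpha> ^ snd (\<phi> v) else 0)"
        by (simp add: comb_eq_sum row_def G_def if_distrib[of "(*) _"] cong: if_cong)
      also have "\<dots> = (\<Sum>v\<in>{v. fst (\<phi> v) = i}. \<iota> (a $ v) * \<alpha> ^ snd (\<phi> v))"
        by (simp add: sum.If_cases)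
      also have "\<dots> = (\<Sum>p<l i. \<iota> (a $ \<psi> (i, p)) * \<alpha> ^ p)"
        by (rule sum.reindex_bij_witness[of _ "\<lambda>p. \<psi> (i, p)" "\<lambda>v. snd (\<phi> v)"])
          (auto simp: \<psi>\<phi> \<phi>\<psi> snd_less)
      finally have "(\<Sum>p<l i. \<iota> (a $ \<psi> (i, p)) * \<alpha> ^ p) = 0" by (rule sym)
      moreover have "snd (\<phi> v) < l i" using snd_less by (simp add: i_def)
      ultimately have "a $ \<psi> (i, snd (\<phi> v)) = 0"
        using powers_independent[OF gen l(2), where a = "\<lambda>p. a $ \<psi> (i, p)"] by blast
      then show ?thesis by (simp add: i_def \<psi>\<phi>)
    qed
    then have "annih (rows G) \<subseteq> {0}" by (auto simp: vec_eq_iff)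
    then have "vec.dim (annih (rows G)) = 0" by (simp only: vec.dim_eq_0)
    then show ?thesis
      using dim_annih_rows[of G]
      by (auto simp: nondegenerate_def generator_matrix_def C_def simp del: vec.dim_eq_0 intro!: exI[of _ G])
  qed
  moreover have "\<exists>c\<in>C. range (($) c) = {x i * \<alpha> ^ p | i p. p < l i}" for x
  proof
    let ?c = "lincomb (*s) (\<lambda>i. row i G) (\<chi> i. x i)"
    show "?c \<in> C" unfolding C_def rows vec.range_lincomb[symmetric] by (rule rangeI)
    show "range (($) ?c) = {x i * \<alpha> ^ p | i p. p < l i}"
    proof
      show "range (($) ?c) \<subseteq> {x i * \<alpha> ^ p | i p. p < l i}" using snd_less by (auto simp: entry)
      show "{x i * \<alpha> ^ p | i p. p < l i} \<subseteq> range (($) ?c)"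
      proof
        fix y assume "y \<in> {x i * \<alpha> ^ p | i p. p < l i}"
        then obtain i p where "p < l i" "y = x i * \<alpha> ^ p" by blast
        then have "y = ?c $ \<psi> (i, p)" by (simp add: entry \<phi>\<psi>)
        then show "y \<in> range (($) ?c)" by blast
      qed
    qed
  qed
  ultimately show ?thesis by blast
qed

theorem code_with_interval_spectrum:
  assumes k: "CARD('k::finite) = Suc j" and g: "0 < g" "g \<le> E.dim UNIV"
    and n: "g + j \<le> CARD('n::finite)" "CARD('n) \<le> reach (E.dim UNIV) g j"
  shows "\<exists>C :: ('e^'n) set. linear_code TYPE('k) C \<and> nondegenerate \<iota> TYPE('k) C \<and>
    {g..min CARD('n) (E.dim UNIV)} \<subseteq> weight_spectrum \<iota> C"
proof -
  obtain \<alpha> :: 'e where gen: "\<And>x. x \<noteq> 0 \<Longrightarrow> \<exists>p. x = \<alpha> ^ p"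
    using finite_field_generator by blast
  obtain l where l: "l 0 = g" "\<forall>i\<le>j. 0 < l i \<and> l i \<le> E.dim UNIV"
    "\<forall>i<j. l (Suc i) \<le> (\<Sum>p\<le>i. l p) + 1" "(\<Sum>i\<le>j. l i) = CARD('n)"
    using lengths_exist[OF g n] by blast
  obtain h :: "'k \<Rightarrow> nat" where h: "bij_betw h UNIV {..j}"
    using finite_same_card_bij[of "UNIV :: 'k set" "{..j}"] k by auto
  then have hj: "h i \<le> j" for i using bij_betwE by fastforce
  have sum: "(\<Sum>i\<in>UNIV. l (h i)) = CARD('n)" using sum.reindex_bij_betw[OF h, of l] l(4) by simp
  have "0 < l (h i)" "l (h i) \<le> E.dim UNIV" for i using l(2) hj by auto
  from block_code_exists[OF gen this sum]
  obtain C :: "('e^'n) set" where C: "linear_code TYPE('k) C" "nondegenerate \<iota> TYPE('k) C"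
    and words: "\<And>x :: 'k \<Rightarrow> 'e. \<exists>c\<in>C. range (($) c) = {x i * \<alpha> ^ p | i p. p < l (h i)}"
    by blast
  have "L \<in> weight_spectrum \<iota> C" if L: "L \<in> {g..min CARD('n) (E.dim UNIV)}" for L
  proof -
    obtain S e where S: "S \<subseteq> {..j}" and e: "(\<Union>i\<in>S. {e i..<e i + l i}) = {..<L}"
      using intervals_cover[of j l L] l L by auto
    \<comment> \<open>Row \<open>h i\<close> is shifted to the start of its interval or dropped. A
      dropped row only contributes the entry 0, which leaves the span unchanged.\<close>
    define x where "x i = (if h i \<in> S then \<alpha> ^ e (h i) else 0)" for i
    obtain c where c: "c \<in> C" "range (($) c) = {x i * \<alpha> ^ p | i p. p < l (h i)}"
      using words by blast
    have "range (($) c) \<subseteq> insert 0 ((^) \<alpha> ` {..<L})"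
    proof
      fix y assume "y \<in> range (($) c)"
      then obtain i p where y: "y = x i * \<alpha> ^ p" "p < l (h i)" unfolding c(2) by blast
      show "y \<in> insert 0 ((^) \<alpha> ` {..<L})"
      proof (cases "h i \<in> S")
        case True
        then have "e (h i) + p \<in> (\<Union>i\<in>S. {e i..<e i + l i})" using y(2) by (intro UN_I) auto
        then have "e (h i) + p \<in> {..<L}" unfolding e .
        moreover have "y = \<alpha> ^ (e (h i) + p)" using True y by (simp add: x_def power_add)
        ultimately show ?thesis by blast
      qed (use y in \<open>simp add: x_def\<close>)
    qed
    moreover have "(^) \<alpha> ` {..<L} \<subseteq> range (($) c)"
    proof
      fix y assume "y \<in> (^) \<alpha> ` {..<L}"
      then obtain r where r: "r < L" "y = \<alpha> ^ r" by auto
      then have "r \<in> (\<Union>i\<in>S. {e i..<e i + l i})" unfolding e by simp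
      then obtain s where s: "s \<in> S" "e s \<le> r" "r < e s + l s" by auto
      have "s \<in> range h" using s(1) S h by (auto simp: bij_betw_def)
      then obtain i where i: "s = h i" by blast
      have "y = x i * \<alpha> ^ (r - e s)" "r - e s < l (h i)"
        using s r i by (auto simp: x_def simp flip: power_add)
      then show "y \<in> range (($) c)" unfolding c(2) by blast
    qed
    ultimately have "E.span (range (($) c)) = E.span ((^) \<alpha> ` {..<L})"
      by (metis E.span_insert_0 E.span_mono subset_antisym)
    then have w: "rank_weight \<iota> c = L"
      using dim_powers[OF gen, of L] L by (simp add: rank_weight_def min_absorb1)
    have "c \<noteq> 0"
    proof
      assume "c = 0"
      then have "range (($) c) \<subseteq> {0}" by auto
      then have "rank_weight \<iota> c = 0" unfolding rank_weight_eq E.dim_eq_0 .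
      with w L g show False by simp
    qed
    then show ?thesis using c(1) w by (auto simp: weight_spectrum_def)
  qed
  then show ?thesis using C by blast
qed

end

section \<open>The maximal number of weights\<close>

context finite_field_extension
begin

lemma L_rk_eq:
  assumes "\<exists>C :: ('e^'n::finite) set. linear_code TYPE('k::finite) C \<and> nondegenerate \<iota> TYPE('k) C \<and>
      v \<le> card (weight_spectrum \<iota> C)"
    and "\<And>C :: ('e^'n) set. linear_code TYPE('k) C \<Longrightarrow> nondegenerate \<iota> TYPE('k) C \<Longrightarrow>
      card (weight_spectrum \<iota> C) \<le> v"
  shows "L_rk \<iota> TYPE('n) TYPE('k) = v"
  unfolding L_rk_def
proof (rule Max_eqI)
  show "finite {card (weight_spectrum \<iota> C) | C :: ('e^'n) set.
      linear_code TYPE('k) C \<and> nondegenerate \<iota> TYPE('k) C}"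
    by (rule finite_subset[of _ "{..v}"]) (use assms(2) in auto)
qed (use assms in \<open>fastforce intro: le_antisym\<close>)+

text \<open>Covers both cases of the formula: \<open>K = k\<close>, \<open>s = n\<close> for
  \<open>n \<le> m\<close>, and \<open>K = t + 2\<close> otherwise. The value \<open>g\<close> is
  the least positive integer with \<open>s < 2 ^ (K - 1) * (g + 1)\<close>, the condition at which
  construction and upper bound meet.\<close>

lemma L_rk_from_parameters:
  fixes n m k K s g :: nat
  assumes n: "CARD('n::finite) = n" and k: "CARD('k::finite) = k" and m: "E.dim UNIV = m"
    and K: "0 < K" "K \<le> k" and s: "n = s + (k - K) * m" "s \<le> 2 * m" "m \<le> s \<or> K = k"
    and kn: "k \<le> n" and m0: "0 < m"
    and g: "g = max (s div 2 ^ (K - 1)) 1" "g \<le> min n m"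
  shows "L_rk \<iota> TYPE('n) TYPE('k) = min n m - g + 1"
proof (rule L_rk_eq)
  have pow: "(2::nat) ^ K = 2 * 2 ^ (K - 1)" using K(1) by (cases K) auto
  have s_less: "s < 2 ^ (K - 1) * (g + 1)"
  proof -
    have "s < 2 ^ (K - 1) * (s div 2 ^ (K - 1) + 1)"
      using dividend_less_times_div[of "2 ^ (K - 1)" s] by simp
    also have "\<dots> \<le> 2 ^ (K - 1) * (g + 1)" using g(1) by (intro mult_left_mono) auto
    finally show ?thesis .
  qed
  \<comment> \<open>Either alternative of \<open>reach_ge_double\<close> suffices: the capped one by
    \<open>s \<le> 2 * m\<close>, the doubling one by \<open>s_less\<close>.\<close>
  have "s \<le> reach m g (K - 1)"
    using reach_ge_double[of m g "K - 1"] s_less s(2) by linarith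
  then have "n \<le> reach m g (K - 1 + (k - K))"
    using s(1,3) reach_ge_linear[of s m g "K - 1" "k - K"] by auto
  then have reach: "n \<le> reach m g (k - 1)" using K by simp
  \<comment> \<open>Leaves room for \<open>k - 1\<close> further positive lengths. For
    \<open>g > 1\<close> it follows from \<open>K * g \<le> 2 ^ (K - 1) * g \<le> s\<close>.\<close>
  have low: "g + (k - 1) \<le> n"
  proof (cases "g = 1")
    case True
    then show ?thesis using kn K by simp
  next
    case False
    then have "g = s div 2 ^ (K - 1)" using g(1) by linarith
    then have "2 ^ (K - 1) * g \<le> s" by simp
    moreover have "K \<le> 2 ^ (K - 1)" using less_exp[of "K - 1"] K(1) by linarith
    then have "K * g \<le> 2 ^ (K - 1) * g" by simp
    moreover have "g + (K - 1) \<le> K * g"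
      using K(1) g(1) by (cases K; cases g) (auto simp: max_def split: if_splits)
    moreover have "k - K \<le> (k - K) * m" using m0 by simp
    ultimately show ?thesis using s(1) K by linarith
  qed
  have k': "CARD('k) = Suc (k - 1)" using k K by simp
  have "0 < g" "g \<le> E.dim UNIV" using g m by simp_all
  from code_with_interval_spectrum[where 'n = 'n, OF k' this, unfolded n m, OF low reach]
  obtain C :: "('e^'n) set" where C: "linear_code TYPE('k) C" "nondegenerate \<iota> TYPE('k) C"
    and sub: "{g..min n m} \<subseteq> weight_spectrum \<iota> C"
    by blast
  have "finite (weight_spectrum \<iota> C)" by (simp add: weight_spectrum_def)
  then have "card {g..min n m} \<le> card (weight_spectrum \<iota> C)" using sub by (rule card_mono)
  then have "min n m - g + 1 \<le> card (weight_spectrum \<iota> C)"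
    unfolding card_atLeastAtMost using g(2) by linarith
  then show "\<exists>C :: ('e^'n) set. linear_code TYPE('k) C \<and> nondegenerate \<iota> TYPE('k) C \<and>
      min n m - g + 1 \<le> card (weight_spectrum \<iota> C)" using C by blast
  fix C :: "('e^'n) set"
  assume C: "linear_code TYPE('k) C" "nondegenerate \<iota> TYPE('k) C"
  obtain h where h: "1 \<le> h" "card (weight_spectrum \<iota> C) + h \<le> min n m + 1"
    "2 * (n + 1) \<le> 2 ^ K * (h + 1) + 2 * (k - K) * m"
    using card_weight_spectrum_le[OF C, of K] K(2) n k m by auto
  \<comment> \<open>Cancelling the capped steps and a factor 2 gives the inequality defining
    \<open>g\<close>, now for \<open>h\<close>; minimality yields \<open>g \<le> h\<close>.\<close>
  have "2 * (s + 1) \<le> 2 ^ K * (h + 1)" using h(3) s(1) by (simp add: algebra_simps)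
  then have "2 * (s + 1) \<le> 2 * (2 ^ (K - 1) * (h + 1))" by (simp only: pow mult.assoc)
  then have "s < 2 ^ (K - 1) * (h + 1)" by (simp only: nat_mult_le_cancel_disj) simp
  then have "s div 2 ^ (K - 1) < h + 1" by (simp add: div_less_iff_less_mult mult.commute)
  then have "g \<le> h" using g(1) h(1) by simp
  then show "card (weight_spectrum \<iota> C) \<le> min n m - g + 1" using h(2) g(2) by linarith
qed

end

lemma floor_real_div_power: "\<lfloor>real a / 2 ^ b\<rfloor> = int (a div 2 ^ b)"
  using floor_divide_of_nat_eq[of a "2 ^ b", where 'a = real] by simp

theorem mainTheorem1:
  fixes q n m k :: nat
    and \<iota> :: "'f::{field,finite} \<Rightarrow> 'e::{field,finite}"
  assumes "primepow q"
    and "CARD('f) = q"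
    and "field_extension_of_degree \<iota> m"
    and "CARD('n::finite) = n" and "CARD('k::finite) = k"
    and "0 < n" and "0 < m" and "0 < k"
    and "k \<le> n" and "n \<le> k * m"
  shows "int (L_rk \<iota> TYPE('n) TYPE('k)) =
    (if n \<le> m then
       int n - max \<lfloor>real n / 2 ^ (k - 1)\<rfloor> 1 + 1
     else
       (let t = nat \<lfloor>real k - real n / real m\<rfloor> in
        int m - max \<lfloor>(real n - (real k - real t - 2) * real m) / 2 ^ (t + 1)\<rfloor> 1 + 1))"
proof -
  interpret finite_field_extension \<iota>
    using assms(3) by unfold_locales (simp add: field_extension_of_degree_def)
  have m: "E.dim UNIV = m" using assms(3) by (simp add: field_extension_of_degree_def)
  note L = L_rk_from_parameters[OF assms(4,5) m]
  show ?thesis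
  proof (cases "n \<le> m")
    case True
    let ?g = "max (n div 2 ^ (k - 1)) 1"
    have g: "?g \<le> n" using assms(6) by simp
    then have "L_rk \<iota> TYPE('n) TYPE('k) = n - ?g + 1"
      using L[of k n ?g] True assms by (simp add: min_absorb1)
    moreover have "int (n - ?g) = int n - max (int (n div 2 ^ (k - 1))) 1"
      using g by (simp only: of_nat_diff of_nat_max of_nat_1)
    ultimately show ?thesis using True by (simp add: floor_real_div_power)
  next
    case False
    define t where "t = nat \<lfloor>real k - real n / real m\<rfloor>"
    \<comment> \<open>Makes the floor nonnegative, so \<open>nat\<close> does not alter it.\<close>
    have "real n / real m \<le> real k"
      using assms(7,10) by (simp add: pos_divide_le_eq flip: of_nat_mult)
    then have t: "real t \<le> real k - real n / real m" "real k - real n / real m < real t + 1"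
      by (simp_all add: t_def)
    have "real (n + t * m) \<le> real (k * m)" "real (k * m) < real (n + (t + 1) * m)"
      using t assms(7) by (simp_all add: field_simps)
    then have tn: "n + t * m \<le> k * m" "k * m < n + (t + 1) * m" by linarith+
    have "(t + 1) * m < k * m" using tn(1) False by simp
    then have "t + 1 < k" by (simp only: mult_less_cancel2)
    then have "t + 2 \<le> k" by simp
    then obtain r where r: "k = t + 2 + r" using le_Suc_ex by blast
    \<comment> \<open>\<open>r\<close> counts the steps beyond \<open>K = t + 2\<close>. The choice
      of \<open>t\<close> as a floor places \<open>s\<close> above \<open>m\<close> and at most at
      \<open>2 * m\<close>.\<close>
    define s where "s = n - r * m"
    have s: "n = s + r * m" "s \<le> 2 * m" "m \<le> s"
      using tn by (auto simp: s_def r algebra_simps)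
    let ?g = "max (s div 2 ^ (t + 1)) 1"
    have "s div 2 ^ (t + 1) \<le> s div 2" by (intro div_le_mono2) auto
    then have g: "?g \<le> m" using s(2) assms(7) by simp
    have "L_rk \<iota> TYPE('n) TYPE('k) = m - ?g + 1"
      using L[of "t + 2" s ?g] s g r False assms by (simp add: min_absorb2)
    moreover have "int (m - ?g) = int m - max (int (s div 2 ^ (t + 1))) 1"
      using g by (simp only: of_nat_diff of_nat_max of_nat_1)
    moreover have "real n - (real k - real t - 2) * real m = real s" using s(1) r by simp
    ultimately show ?thesis
      using False by (simp only: Let_def floor_real_div_power flip: t_def) simp
  qed
qed

end
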